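(* If $Q$ is an $(n+1)\times(n+1)$ nonnegative bisymmetric matrix with eigenvalues (counted with multiplicity) $\lambda_0\ge\lambda_1\ge\dots\ge\lambda_n$ and $\varepsilon>0$, then there is an $(n+1)\times(n+1)$ positive bisymmetric matrix $\hat{Q}$ with eigenvalues $\lambda_0+\varepsilon,\lambda_1,\dots,\lambda_n$.
   Context: All matrices are real. A square matrix $Q$ is bisymmetric if $Q^T=Q$ and $JQJ=Q$, where $J$ is the reverse identity matrix (ones on the anti-diagonal, zeros elsewhere). A matrix is nonnegative (positive) if all its entries are $\ge 0$ ($>0$). *)

theory Defs
  imports "Jordan_Normal_Form.Char_Poly"
begin

definition reverse_identity_mat :: "nat \<Rightarrow> 'a :: {zero,one} mat" where
  "reverse_identity_mat m = mat m m (\<lambda>(i, j). if i + j + 1 = m then 1 else 0)"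

definition bisymmetric_mat :: "'a :: semiring_1 mat \<Rightarrow> bool" where
  "bisymmetric_mat Q \<longleftrightarrow>
     square_mat Q \<and> Q\<^sup>T = Q \<and>
     reverse_identity_mat (dim_row Q) * Q * reverse_identity_mat (dim_row Q) = Q"

definition nonnegative_mat :: "real mat \<Rightarrow> bool" where
  "nonnegative_mat A \<longleftrightarrow> (\<forall>i<dim_row A. \<forall>j<dim_col A. 0 \<le> A $$ (i, j))"

definition positive_mat :: "real mat \<Rightarrow> bool" where
  "positive_mat A \<longleftrightarrow> (\<forall>i<dim_row A. \<forall>j<dim_col A. 0 < A $$ (i, j))"

(* The values ev 0, ..., ev (dim_row A - 1), in any order, are all the eigenvalues of A
   repeated according to algebraic multiplicity; values of ev at larger indices are ignored. *)
definition has_eigenvalues :: "real mat \<Rightarrow> (nat \<Rightarrow> real) \<Rightarrow> bool" where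
  "has_eigenvalues A ev \<longleftrightarrow> char_poly A = (\<Prod>i<dim_row A. [:- ev i, 1:])"

end

(* Let v be a nonnegative unit Perron vector of Q fixed by J, with Qv = lambda_0 v. Then
   Q + eps v v^T is nonnegative and bisymmetric, has the required spectrum, and is positive on the
   support of v. If v vanishes on an index set Z, then Q splits along Z; take a Perron vector w of
   the block on Z, again fixed by J, with eigenvalue mu <= lambda_0, and rotate v slightly towards w,
   that is, put v' = c v + s w with c^2 + s^2 = 1 and replace Q by
   Q - (lambda_0 - mu) v v^T + (lambda_0 - mu) v' v'^T. The matrix Q - (lambda_0 - mu) v v^T has
   eigenvalue mu at both v and v', so the spectrum is unchanged, while for small s the properties
   above persist and the support has grown by that of w. Iterate until Z is empty. *)
theory Submission
  imports "HOL-Analysis.Function_Topology" Defs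
begin

section \<open>Perron vectors of nonnegative symmetric arrays\<close>

text \<open>A continuous function attains its maximum on the compact unit sphere, and homogeneity of
  degree two carries the bound to every \<open>x\<close>. Multiplying by the squared norm instead of
  dividing by it includes \<open>x = 0\<close>.\<close>

lemma rayleigh_quotient_attains_max:
  fixes a :: "'i \<Rightarrow> 'i \<Rightarrow> real"
  assumes "finite Z" "Z \<noteq> {}"
  shows "\<exists>w. (\<Sum>i\<in>Z. (w i)\<^sup>2) = 1 \<and>
    (\<forall>x. (\<Sum>i\<in>Z. \<Sum>j\<in>Z. a i j * x i * x j)
          \<le> (\<Sum>i\<in>Z. \<Sum>j\<in>Z. a i j * w i * w j) * (\<Sum>i\<in>Z. (x i)\<^sup>2))"
proof -
  define q where "q = (\<lambda>x. \<Sum>i\<in>Z. \<Sum>j\<in>Z. a i j * x i * x j)"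
  define g :: "('i \<Rightarrow> real) \<Rightarrow> real" where "g = (\<lambda>x. \<Sum>i\<in>Z. (x i)\<^sup>2)"
  \<comment> \<open>The type \<open>'i\<close> may be infinite, so coordinates outside
    \<open>Z\<close> are pinned to 0; the box is then compact by Tychonoff, and \<open>S\<close> is
    a closed part of it.\<close>
  define S :: "('i \<Rightarrow> real) set" where "S = (\<Pi>\<^sub>E i\<in>UNIV. if i \<in> Z then {-1..1} else {0}) \<inter> {x. g x = 1}"
  have "compactin euclidean (\<Pi>\<^sub>E i\<in>UNIV. if i \<in> Z then {-1..1::real} else {0})"
    unfolding euclidean_product_topology[symmetric] compactin_PiE by auto
  moreover have cg: "continuous_on UNIV g" and cq: "continuous_on UNIV q"
    unfolding g_def q_def by (intro continuous_intros continuous_on_product_coordinates)+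
  moreover have "closed {x. g x = 1}"
    using closed_Collect_eq[OF cg continuous_on_const[of UNIV 1]] by simp
  ultimately have "compact S" unfolding S_def by (auto intro: compact_Int_closed)
  moreover obtain k where k: "k \<in> Z" using assms by blast
  have "(\<Sum>i\<in>Z. (if i = k then 1 else 0::real)\<^sup>2) = 1"
    using assms k by (subst sum.remove[of _ k]) auto
  then have "(\<lambda>i. if i = k then 1 else 0) \<in> S" using k unfolding S_def g_def by auto
  then have "S \<noteq> {}" by blast
  ultimately obtain w where w: "w \<in> S" "\<And>y. y \<in> S \<Longrightarrow> q y \<le> q w"
    using continuous_attains_sup[of S q] continuous_on_subset[OF cq] by blast
  have "q x \<le> q w * g x" for x
  proof (cases "g x = 0")
    case True
    then have "\<And>i. i \<in> Z \<Longrightarrow> x i = 0" using assms unfolding g_def by (simp add: sum_nonneg_eq_0_iff)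
    then have "q x = 0" unfolding q_def by simp
    then show ?thesis using True by simp
  next
    case False
    moreover have "g x \<ge> 0" unfolding g_def by (simp add: sum_nonneg)
    ultimately have pos: "g x > 0" by simp
    define y where "y = (\<lambda>i. if i \<in> Z then x i / sqrt (g x) else 0)"
    have "g y = (\<Sum>i\<in>Z. (x i)\<^sup>2 / g x)" using pos unfolding g_def
      by (intro sum.cong) (auto simp: y_def power_divide g_def)
    also have "\<dots> = 1" using pos by (simp add: g_def flip: sum_divide_distrib)
    finally have gy: "g y = 1" .
    have "(y i)\<^sup>2 \<le> 1" if "i \<in> Z" for i
      using member_le_sum[of i Z "\<lambda>i. (y i)\<^sup>2"] gy assms that unfolding g_def by simp
    then have "\<bar>y i\<bar> \<le> 1" if "i \<in> Z" for i using that by (simp add: abs_square_le_1)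
    moreover have "y i = 0" if "i \<notin> Z" for i using that by (simp add: y_def)
    ultimately have "y \<in> S" using gy unfolding S_def by (auto simp: abs_le_iff minus_le_iff)
    then have "q y \<le> q w" by (rule w)
    moreover have "q y = (\<Sum>i\<in>Z. \<Sum>j\<in>Z. a i j * x i * x j / g x)"
      unfolding q_def using pos by (intro sum.cong refl) (simp add: y_def flip: power2_eq_square)
    then have "q y = q x / g x" by (simp add: q_def sum_divide_distrib)
    ultimately show ?thesis using pos by (simp add: field_simps)
  qed
  then show ?thesis using w(1) unfolding S_def q_def g_def by blast
qed

text \<open>First-order variation: at \<open>w\<close> the bound is attained, and moving from
  \<open>w\<close> along the residual \<open>r\<close> would violate it at first order unless
  \<open>r\<close> vanishes.\<close>

lemma rayleigh_max_eigenvector: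
  fixes a :: "'i \<Rightarrow> 'i \<Rightarrow> real"
  assumes "finite Z"
    and sym: "\<And>i j. i \<in> Z \<Longrightarrow> j \<in> Z \<Longrightarrow> a i j = a j i"
    and max: "\<And>x. (\<Sum>i\<in>Z. \<Sum>j\<in>Z. a i j * x i * x j) \<le> \<mu> * (\<Sum>i\<in>Z. (x i)\<^sup>2)"
    and w: "(\<Sum>i\<in>Z. \<Sum>j\<in>Z. a i j * w i * w j) = \<mu> * (\<Sum>i\<in>Z. (w i)\<^sup>2)"
    and "k \<in> Z"
  shows "(\<Sum>j\<in>Z. a k j * w j) = \<mu> * w k"
proof -
  define r where "r = (\<lambda>i. (\<Sum>j\<in>Z. a i j * w j) - \<mu> * w i)"
  define p where "p = (\<Sum>i\<in>Z. (r i)\<^sup>2)"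
  define c where "c = \<mu> * p - (\<Sum>i\<in>Z. \<Sum>j\<in>Z. a i j * r i * r j)"
  have p0: "p \<ge> 0" unfolding p_def by (simp add: sum_nonneg)
  have c0: "c \<ge> 0" unfolding c_def p_def using max[of r] by simp
  have rw: "(\<Sum>i\<in>Z. \<Sum>j\<in>Z. a i j * r i * w j) = p + \<mu> * (\<Sum>i\<in>Z. r i * w i)"
    unfolding p_def sum_distrib_left
    by (simp add: r_def sum_subtractf power2_eq_square algebra_simps sum_distrib_left sum.distrib flip: sum.distrib)
  have wr: "(\<Sum>i\<in>Z. \<Sum>j\<in>Z. a i j * w i * r j) = (\<Sum>i\<in>Z. \<Sum>j\<in>Z. a i j * r i * w j)"
    by (subst sum.swap) (intro sum.cong refl, simp add: sym)
  \<comment> \<open>The bound is taken at \<open>w + t * r\<close>. The constant terms cancel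
    because \<open>w\<close> attains the bound, and so do the products of \<open>r\<close> and
    \<open>w\<close> carrying the factor \<open>\<mu>\<close>.\<close>
  have *: "2 * t * p \<le> t\<^sup>2 * c" for t
  proof -
    have "(\<Sum>i\<in>Z. \<Sum>j\<in>Z. a i j * (w i + t * r i) * (w j + t * r j))
      = (\<Sum>i\<in>Z. \<Sum>j\<in>Z. a i j * w i * w j + t * (a i j * w i * r j) + t * (a i j * r i * w j)
          + t\<^sup>2 * (a i j * r i * r j))"
      by (intro sum.cong refl) (simp add: algebra_simps power2_eq_square)
    also have "\<dots> = \<mu> * (\<Sum>i\<in>Z. (w i)\<^sup>2) + 2 * t * (p + \<mu> * (\<Sum>i\<in>Z. r i * w i)) + t\<^sup>2 * (\<mu> * p - c)"
      by (simp add: sum.distrib w wr rw c_def flip: sum_distrib_left)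
    finally have 1: "(\<Sum>i\<in>Z. \<Sum>j\<in>Z. a i j * (w i + t * r i) * (w j + t * r j)) = \<dots>" .
    have "(\<Sum>i\<in>Z. (w i + t * r i)\<^sup>2) = (\<Sum>i\<in>Z. (w i)\<^sup>2 + 2 * t * (r i * w i) + t\<^sup>2 * (r i)\<^sup>2)"
      by (intro sum.cong refl) (simp add: algebra_simps power2_eq_square)
    also have "\<dots> = (\<Sum>i\<in>Z. (w i)\<^sup>2) + 2 * t * (\<Sum>i\<in>Z. r i * w i) + t\<^sup>2 * p"
      by (simp add: sum.distrib p_def flip: sum_distrib_left)
    finally have 2: "(\<Sum>i\<in>Z. (w i + t * r i)\<^sup>2) = \<dots>" .
    show ?thesis using max[of "\<lambda>i. w i + t * r i"] unfolding 1 2 by (simp add: algebra_simps)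
  qed
  \<comment> \<open>For small positive \<open>t\<close> the linear term dominates;
    \<open>c + 1\<close> instead of \<open>c\<close> keeps the denominator positive when
    \<open>c = 0\<close>.\<close>
  have "2 * (p / (c + 1)) * p \<le> (p / (c + 1))\<^sup>2 * c" by (rule *)
  also have "\<dots> \<le> (p / (c + 1))\<^sup>2 * (c + 1)" by (intro mult_left_mono) auto
  also have "\<dots> = (p / (c + 1)) * p" using c0 by (simp add: power2_eq_square)
  finally have "p * p \<le> 0" using c0 by (simp add: divide_le_cancel)
  then have "p = 0" by (auto simp: mult_le_0_iff)
  then have "r k = 0" using assms unfolding p_def by (simp add: sum_nonneg_eq_0_iff)
  then show ?thesis unfolding r_def by simp
qed

text \<open>Since \<open>a\<close> is nonnegative, taking absolute values of a maximiser cannot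
  lower the form, so the result is again a maximiser and hence an eigenvector. Its composition with
  \<open>\<sigma>\<close> is an eigenvector for the same \<open>\<mu>\<close>, and the sum of the
  two is fixed by the involution. The last conclusion says that \<open>\<mu>\<close> bounds all
  Rayleigh quotients, which later identifies it with the largest eigenvalue.\<close>

lemma nonneg_symmetric_perron:
  fixes a :: "'i \<Rightarrow> 'i \<Rightarrow> real"
  assumes fin: "finite Z" and ne: "Z \<noteq> {}"
    and sym: "\<And>i j. i \<in> Z \<Longrightarrow> j \<in> Z \<Longrightarrow> a i j = a j i"
    and nonneg: "\<And>i j. i \<in> Z \<Longrightarrow> j \<in> Z \<Longrightarrow> 0 \<le> a i j"
    and \<sigma>: "\<And>i. i \<in> Z \<Longrightarrow> \<sigma> i \<in> Z" "\<And>i. i \<in> Z \<Longrightarrow> \<sigma> (\<sigma> i) = i"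
    and a\<sigma>: "\<And>i j. i \<in> Z \<Longrightarrow> j \<in> Z \<Longrightarrow> a (\<sigma> i) (\<sigma> j) = a i j"
  obtains w \<mu> where "\<And>i. 0 \<le> w i" "\<And>i. i \<notin> Z \<Longrightarrow> w i = 0" "\<And>i. i \<in> Z \<Longrightarrow> w (\<sigma> i) = w i"
    "(\<Sum>i\<in>Z. (w i)\<^sup>2) = 1" "\<And>i. i \<in> Z \<Longrightarrow> (\<Sum>j\<in>Z. a i j * w j) = \<mu> * w i"
    "\<And>x. (\<Sum>i\<in>Z. \<Sum>j\<in>Z. a i j * x i * x j) \<le> \<mu> * (\<Sum>i\<in>Z. (x i)\<^sup>2)"
proof -
  obtain w where w1: "(\<Sum>i\<in>Z. (w i)\<^sup>2) = 1"
    and wmax: "\<And>x. (\<Sum>i\<in>Z. \<Sum>j\<in>Z. a i j * x i * x j)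
          \<le> (\<Sum>i\<in>Z. \<Sum>j\<in>Z. a i j * w i * w j) * (\<Sum>i\<in>Z. (x i)\<^sup>2)"
    using rayleigh_quotient_attains_max[OF fin ne, of a] by blast
  define \<mu> where "\<mu> = (\<Sum>i\<in>Z. \<Sum>j\<in>Z. a i j * w i * w j)"
  have max: "(\<Sum>i\<in>Z. \<Sum>j\<in>Z. a i j * x i * x j) \<le> \<mu> * (\<Sum>i\<in>Z. (x i)\<^sup>2)" for x
    using wmax unfolding \<mu>_def .
  have "\<mu> \<le> (\<Sum>i\<in>Z. \<Sum>j\<in>Z. a i j * \<bar>w i\<bar> * \<bar>w j\<bar>)"
    unfolding \<mu>_def mult.assoc using nonneg
    by (intro sum_mono mult_left_mono) (auto simp flip: abs_mult)
  then have "(\<Sum>i\<in>Z. \<Sum>j\<in>Z. a i j * \<bar>w i\<bar> * \<bar>w j\<bar>) = \<mu> * (\<Sum>i\<in>Z. \<bar>w i\<bar>\<^sup>2)"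
    using max[of "\<lambda>i. \<bar>w i\<bar>"] by (simp add: w1)
  then have eig: "(\<Sum>j\<in>Z. a i j * \<bar>w j\<bar>) = \<mu> * \<bar>w i\<bar>" if "i \<in> Z" for i
    using rayleigh_max_eigenvector[OF fin sym max, of "\<lambda>i. \<bar>w i\<bar>"] that by blast
  have bij: "bij_betw \<sigma> Z Z" by (rule bij_betw_byWitness[where f' = \<sigma>]) (use \<sigma> in auto)
  have eig\<sigma>: "(\<Sum>j\<in>Z. a i j * \<bar>w (\<sigma> j)\<bar>) = \<mu> * \<bar>w (\<sigma> i)\<bar>" if i: "i \<in> Z" for i
  proof -
    have "(\<Sum>j\<in>Z. a i j * \<bar>w (\<sigma> j)\<bar>) = (\<Sum>j\<in>Z. a (\<sigma> i) (\<sigma> j) * \<bar>w (\<sigma> j)\<bar>)"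
      using i a\<sigma> by (intro sum.cong) auto
    also have "\<dots> = (\<Sum>j\<in>Z. a (\<sigma> i) j * \<bar>w j\<bar>)"
      using bij by (rule sum.reindex_bij_betw)
    finally show ?thesis using eig \<sigma> i by simp
  qed
  \<comment> \<open>Both summands are nonnegative, so they cannot cancel and the sum can be
    normalised.\<close>
  define s where "s = (\<Sum>i\<in>Z. (\<bar>w i\<bar> + \<bar>w (\<sigma> i)\<bar>)\<^sup>2)"
  have "(w i)\<^sup>2 \<le> (\<bar>w i\<bar> + \<bar>w (\<sigma> i)\<bar>)\<^sup>2" for i
    by (simp add: power2_le_iff_abs_le)
  then have "1 \<le> s" unfolding s_def w1[symmetric] by (rule sum_mono)
  then have s: "s > 0" by simp
  define u where "u = (\<lambda>i. if i \<in> Z then (\<bar>w i\<bar> + \<bar>w (\<sigma> i)\<bar>) / sqrt s else 0)"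
  show ?thesis
  proof (rule that[of u \<mu>])
    show "(\<Sum>i\<in>Z. (u i)\<^sup>2) = 1"
      using s by (simp add: u_def power_divide s_def flip: sum_divide_distrib)
    show "(\<Sum>j\<in>Z. a i j * u j) = \<mu> * u i" if "i \<in> Z" for i
      using eig[OF that] eig\<sigma>[OF that] that
      by (simp add: u_def distrib_left add_divide_distrib sum.distrib flip: sum_divide_distrib)
  qed (use s \<sigma> max in \<open>auto simp: u_def\<close>)
qed

section \<open>The characteristic polynomial under rank-one updates\<close>

text \<open>Laplace expansion along the first column writes each characteristic polynomial as a
  linear factor times the cofactor at the corner. The cofactors agree because they do not see the
  only changed entry. Cross-multiplication avoids dividing polynomials.\<close>

lemma char_poly_first_column_update:
  fixes B B' :: "'a :: comm_ring_1 mat"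
  assumes B: "B \<in> carrier_mat (Suc n) (Suc n)" and B': "B' \<in> carrier_mat (Suc n) (Suc n)"
    and col: "\<And>i. i < Suc n \<Longrightarrow> B $$ (i, 0) = (if i = 0 then \<mu> else 0)"
    and upd: "\<And>i j. i < Suc n \<Longrightarrow> j < Suc n \<Longrightarrow>
      B' $$ (i, j) = B $$ (i, j) + (if i = 0 \<and> j = 0 then \<eta> else 0)"
  shows "char_poly B' * [:- \<mu>, 1:] = char_poly B * [:- (\<mu> + \<eta>), 1:]"
proof -
  have del: "mat_delete (char_poly_matrix B') 0 0 = mat_delete (char_poly_matrix B) 0 0"
    using B B' upd by (intro eq_matI) (auto simp: mat_delete_def char_poly_matrix_def)
  have *: "char_poly A = A0 * cofactor (char_poly_matrix A) 0 0"
    if A: "A \<in> carrier_mat (Suc n) (Suc n)"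
      and c: "\<And>i. i < Suc n \<Longrightarrow> char_poly_matrix A $$ (i, 0) = (if i = 0 then A0 else 0)" for A :: "'a mat" and A0
  proof -
    have "char_poly A = (\<Sum>i<Suc n. char_poly_matrix A $$ (i, 0) * cofactor (char_poly_matrix A) i 0)"
      unfolding char_poly_def using A by (intro laplace_expansion_column) auto
    then show ?thesis by (simp add: c sum.lessThan_Suc_shift del: sum.lessThan_Suc)
  qed
  have "char_poly B = [:- \<mu>, 1:] * cofactor (char_poly_matrix B) 0 0"
    using B col by (intro *) (auto simp: char_poly_matrix_def)
  moreover have "char_poly B' = [:- (\<mu> + \<eta>), 1:] * cofactor (char_poly_matrix B') 0 0"
    using B B' col upd by (intro *) (auto simp: char_poly_matrix_def)
  ultimately show ?thesis unfolding cofactor_def del by (simp only: mult_ac)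
qed

text \<open>The Householder reflection along the difference \<open>u\<close> of \<open>v\<close> and
  the first unit vector exchanges these two vectors.\<close>

lemma householder_to_first_unit_vector:
  fixes v :: "nat \<Rightarrow> real"
  assumes v1: "(\<Sum>i<Suc n. (v i)\<^sup>2) = 1"
  obtains H where "H \<in> carrier_mat (Suc n) (Suc n)" "H\<^sup>T = H" "H * H = 1\<^sub>m (Suc n)"
    "\<And>i. i < Suc n \<Longrightarrow> (\<Sum>j<Suc n. H $$ (i, j) * v j) = (if i = 0 then 1 else 0)"
proof -
  define N where "N = Suc n"
  define u where "u = (\<lambda>i. v i - (if i = 0 then 1 else 0))"
  define g where "g = (\<Sum>i<N. (u i)\<^sup>2)"
  define \<tau> where "\<tau> = 2 / g"  \<comment> \<open>if \<open>v\<close> is the first unit vector, then \<open>g = 0\<close>, so \<open>\<tau> = 0\<close> and \<open>H = 1\<close>\<close>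
  define H where "H = mat N N (\<lambda>(i, j). (if i = j then 1 else 0) - \<tau> * (u i * u j))"
  have g2: "g = 2 * (1 - v 0)"
  proof -
    have "g = (\<Sum>i<N. (v i)\<^sup>2 - (if i = 0 then 2 * v 0 - 1 else 0))"
      unfolding g_def u_def by (intro sum.cong) (auto simp: power2_eq_square algebra_simps)
    then show ?thesis by (simp add: sum_subtractf v1 N_def del: sum.lessThan_Suc)
  qed
  have uv: "(\<Sum>i<N. u i * v i) = 1 - v 0"
  proof -
    have "(\<Sum>i<N. u i * v i) = (\<Sum>i<N. (v i)\<^sup>2 - (if i = 0 then v 0 else 0))"
      unfolding u_def by (intro sum.cong) (auto simp: power2_eq_square algebra_simps)
    then show ?thesis by (simp add: sum_subtractf v1 N_def del: sum.lessThan_Suc)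
  qed
  \<comment> \<open>By the two identities above, \<open>g\<close> is twice the inner product of
    \<open>u\<close> and \<open>v\<close>, so the reflection subtracts exactly \<open>u\<close> from
    \<open>v\<close>. If \<open>g = 0\<close> then \<open>u\<close> vanishes and nothing has to be
    subtracted.\<close>
  have \<tau>uv: "\<tau> * (1 - v 0) * u i = u i" if "i < N" for i
  proof (cases "g = 0")
    case True
    then have "u i = 0" using that unfolding g_def by (simp add: sum_nonneg_eq_0_iff)
    then show ?thesis by simp
  next
    case False
    then show ?thesis unfolding \<tau>_def g2 by simp
  qed
  show ?thesis
  proof (rule that[of H, folded N_def])
    show "H \<in> carrier_mat N N" unfolding H_def by simp
    show "H\<^sup>T = H" unfolding H_def by (intro eq_matI) (auto simp: mult.commute)
    show "H * H = 1\<^sub>m N"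
    proof (rule eq_matI)
      fix i j assume "i < dim_row (1\<^sub>m N)" "j < dim_col (1\<^sub>m N)"
      then have ij: "i < N" "j < N" by auto
      have "(H * H) $$ (i, j) = (\<Sum>k<N. ((if i = k then 1 else 0) - \<tau> * (u i * u k)) *
          ((if k = j then 1 else 0) - \<tau> * (u k * u j)))"
        using ij by (simp add: H_def scalar_prod_def atLeast0LessThan)
      also have "\<dots> = (\<Sum>k<N. (if k = i then (if i = j then 1 else 0) - \<tau> * (u i * u j) else 0)
          - (if k = j then \<tau> * (u i * u j) else 0) + \<tau> * \<tau> * (u i * u j) * (u k)\<^sup>2)"
        by (intro sum.cong) (auto simp: algebra_simps power2_eq_square)
      also have "\<dots> = (if i = j then 1 else 0) - 2 * \<tau> * (u i * u j) + \<tau> * \<tau> * (u i * u j) * g"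
        using ij by (simp add: sum.distrib sum_subtractf g_def sum_distrib_left)
      also have "\<tau> * \<tau> * (u i * u j) * g = 2 * \<tau> * (u i * u j)"
        unfolding \<tau>_def by simp
      finally show "(H * H) $$ (i, j) = 1\<^sub>m N $$ (i, j)" using ij by simp
    qed (auto simp: H_def)
    show "(\<Sum>j<N. H $$ (i, j) * v j) = (if i = 0 then 1 else 0)" if i: "i < N" for i
    proof -
      have "(\<Sum>j<N. H $$ (i, j) * v j) = (\<Sum>j<N. (if j = i then v i else 0) - \<tau> * u i * (u j * v j))"
        using i by (intro sum.cong) (auto simp: H_def algebra_simps)
      also have "\<dots> = v i - \<tau> * (1 - v 0) * u i"
        using i by (simp add: sum_subtractf uv flip: sum_distrib_left)
      finally show ?thesis unfolding \<tau>uv[OF i] by (simp add: u_def)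
    qed
  qed
qed

text \<open>Conjugation by the reflection sending \<open>v\<close> to the first unit vector turns
  the eigenvalue equation into a first column that is zero below the corner entry
  \<open>\<mu>\<close>, and turns the rank-one term into a change of that corner alone. One
  eigenvalue moves from \<open>\<mu>\<close> to \<open>\<mu> + \<eta>\<close> and the others
  stay.\<close>

lemma char_poly_rank_one_update:
  fixes c :: "nat \<Rightarrow> nat \<Rightarrow> real"
  assumes v1: "(\<Sum>i<N. (v i)\<^sup>2) = 1"
    and ev: "\<And>i. i < N \<Longrightarrow> (\<Sum>j<N. c i j * v j) = \<mu> * v i"
  shows "char_poly (mat N N (\<lambda>(i, j). c i j + \<eta> * v i * v j)) * [:- \<mu>, 1:] =
    char_poly (mat N N (\<lambda>(i, j). c i j)) * [:- (\<mu> + \<eta>), 1:]"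
proof -
  obtain n where N: "N = Suc n" using v1 by (cases N) auto
  obtain H where H: "H \<in> carrier_mat N N" and HT: "H\<^sup>T = H" and HH: "H * H = 1\<^sub>m N"
    and Hv: "\<And>i. i < N \<Longrightarrow> (\<Sum>j<N. H $$ (i, j) * v j) = (if i = 0 then 1 else 0)"
    using householder_to_first_unit_vector v1 unfolding N by metis
  define C where "C = mat N N (\<lambda>(i, j). c i j)"
  \<comment> \<open>Vectors are one-column matrices here, so that outer products and associativity
    are handled by matrix multiplication alone.\<close>
  define V where "V = mat N 1 (\<lambda>(i, j). v i)"
  define E :: "real mat" where "E = mat N 1 (\<lambda>(i, j). if i = 0 then 1 else 0)"
  have [simp]: "C \<in> carrier_mat N N" "V \<in> carrier_mat N 1" "E \<in> carrier_mat N 1" "H \<in> carrier_mat N N"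
    unfolding C_def V_def E_def using H by auto
  note [simp] = carrier_matD[OF H] and [simp del] = One_nat_def
  have CV: "C * V = \<mu> \<cdot>\<^sub>m V"
    by (rule eq_matI) (auto simp: C_def V_def scalar_prod_def atLeast0LessThan ev)
  have HV: "H * V = E"
    using H Hv by (intro eq_matI) (auto simp: E_def V_def scalar_prod_def atLeast0LessThan)
  have HE: "H * E = V"
    unfolding HV[symmetric] by (subst assoc_mult_mat[symmetric, of _ N N _ N _ 1])
      (auto simp: HH left_mult_one_mat[of V N 1])
  have upd: "mat N N (\<lambda>(i, j). c i j + \<eta> * v i * v j) = C + \<eta> \<cdot>\<^sub>m (V * V\<^sup>T)"
    by (rule eq_matI) (auto simp: C_def V_def scalar_prod_def)
  have "H * (C + \<eta> \<cdot>\<^sub>m W) * H = H * C * H + \<eta> \<cdot>\<^sub>m (H * W * H)" if W: "W \<in> carrier_mat N N" for W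
  proof -
    have "H * (C + \<eta> \<cdot>\<^sub>m W) = H * C + \<eta> \<cdot>\<^sub>m (H * W)"
      using W by (simp add: mult_add_distrib_mat[of H N N C N] mult_smult_distrib[of H N N W N])
    moreover have "(H * C + \<eta> \<cdot>\<^sub>m (H * W)) * H = H * C * H + \<eta> \<cdot>\<^sub>m (H * W * H)"
      using W by (subst add_mult_distrib_mat[of _ N N _ _ N])
        (auto simp: mult_smult_assoc_mat[of _ N N _ N] intro: mult_carrier_mat[of _ N N])
    ultimately show ?thesis by simp
  qed
  from this[of "V * V\<^sup>T"]
  have "H * (C + \<eta> \<cdot>\<^sub>m (V * V\<^sup>T)) * H = H * C * H + \<eta> \<cdot>\<^sub>m (H * (V * V\<^sup>T) * H)"
    by (simp add: mult_carrier_mat[of V N 1])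
  also have "H * (V * V\<^sup>T) * H = E * E\<^sup>T"
  proof -
    have "E * E\<^sup>T = H * V * (V\<^sup>T * H)"
      unfolding HV[symmetric] by (subst transpose_mult[of _ N N _ 1]) (auto simp: HT)
    also have "\<dots> = H * V * V\<^sup>T * H"
      by (rule assoc_mult_mat[of _ N 1 _ N _ N, symmetric]) (auto simp: mult_carrier_mat[of H N N])
    also have "H * V * V\<^sup>T = H * (V * V\<^sup>T)"
      by (rule assoc_mult_mat[of _ N N _ 1 _ N]) auto
    finally show ?thesis by simp
  qed
  finally have conj: "H * (C + \<eta> \<cdot>\<^sub>m (V * V\<^sup>T)) * H = H * C * H + \<eta> \<cdot>\<^sub>m (E * E\<^sup>T)" .
  have sim: "char_poly (H * A * H) = char_poly A" if "A \<in> carrier_mat N N" for A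
  proof (rule char_poly_similar)
    show "similar_mat (H * A * H) A"
      unfolding similar_mat_def similar_mat_wit_def Let_def
      by (rule exI[of _ H], rule exI[of _ H]) (use that HH H in auto)
  qed
  \<comment> \<open>Multiplication by \<open>E\<close> extracts the first column of the conjugated
    matrix.\<close>
  have "H * C * H * E = H * C * (H * E)"
    by (rule assoc_mult_mat[of _ N N _ N _ 1]) (auto simp: mult_carrier_mat[of H N N])
  also have "\<dots> = H * (C * (H * E))"
    by (rule assoc_mult_mat[of _ N N _ N _ 1]) (auto simp: mult_carrier_mat[of H N N])
  also have "\<dots> = \<mu> \<cdot>\<^sub>m E"
    unfolding HE CV by (subst mult_smult_distrib[of _ N N _ 1]) (auto simp: HV)
  finally have col: "H * C * H * E = \<mu> \<cdot>\<^sub>m E" .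
  have "char_poly (H * C * H + \<eta> \<cdot>\<^sub>m (E * E\<^sup>T)) * [:- \<mu>, 1:] =
      char_poly (H * C * H) * [:- (\<mu> + \<eta>), 1:]"
  proof (rule char_poly_first_column_update[of _ n])
    fix i assume i: "i < Suc n"
    have "(H * C * H * E) $$ (i, 0) = (H * C * H) $$ (i, 0)"
    proof -
      have "(H * C * H * E) $$ (i, 0) = (\<Sum>j<N. (H * C * H) $$ (i, j) * E $$ (j, 0))"
        using i unfolding times_mat_def[of _ E]
        by (auto simp: N C_def E_def scalar_prod_def atLeast0LessThan simp del: sum.lessThan_Suc
            intro!: sum.cong)
      also have "\<dots> = (\<Sum>j<N. if j = 0 then (H * C * H) $$ (i, j) else 0)"
        by (intro sum.cong) (auto simp: E_def)
      finally show ?thesis by (simp add: N)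
    qed
    then show "(H * C * H) $$ (i, 0) = (if i = 0 then \<mu> else 0)"
      unfolding col using i by (auto simp: E_def N simp del: index_mult_mat split: if_splits)
  qed (use H in \<open>auto simp: N E_def C_def scalar_prod_def\<close>)
  moreover have "C + \<eta> \<cdot>\<^sub>m (V * V\<^sup>T) \<in> carrier_mat N N"
    by (simp add: mult_carrier_mat[of V N 1])
  ultimately show ?thesis
    unfolding upd C_def[symmetric] conj[symmetric] by (simp only: sim \<open>C \<in> carrier_mat N N\<close>)
qed

lemma eigenfunction_root_char_poly:
  fixes b :: "nat \<Rightarrow> nat \<Rightarrow> 'a :: field"
  assumes ev: "\<And>i. i < N \<Longrightarrow> (\<Sum>j<N. b i j * w j) = \<mu> * w i"
    and "k < N" "w k \<noteq> 0"
  shows "poly (char_poly (mat N N (\<lambda>(i, j). b i j))) \<mu> = 0"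
proof -
  have "mat N N (\<lambda>(i, j). b i j) *\<^sub>v vec N w = \<mu> \<cdot>\<^sub>v vec N w"
    by (rule eq_vecI) (auto simp: ev scalar_prod_def atLeast0LessThan)
  moreover have "vec N w \<noteq> 0\<^sub>v N"
    using assms(2,3) by (metis index_vec index_zero_vec(1))
  ultimately have "eigenvector (mat N N (\<lambda>(i, j). b i j)) (vec N w) \<mu>"
    unfolding eigenvector_def by simp
  then show ?thesis
    by (subst eigenvalue_root_char_poly[symmetric, of _ N]) (auto simp: eigenvalue_def)
qed

section \<open>Bisymmetry as a condition on entries\<close>

text \<open>Multiplication by the reverse identity on the left reverses the rows, on the right the
  columns. Afterwards this matrix enters only through the involution sending \<open>i\<close> to
  \<open>N - 1 - i\<close>.\<close>

lemma bisymmetric_mat_iff: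
  fixes Q :: "'a :: semiring_1 mat"
  assumes Q: "Q \<in> carrier_mat N N"
  shows "bisymmetric_mat Q \<longleftrightarrow>
    (\<forall>i<N. \<forall>j<N. Q $$ (i, j) = Q $$ (j, i) \<and> Q $$ (N - 1 - i, N - 1 - j) = Q $$ (i, j))"
proof -
  let ?J = "reverse_identity_mat N :: 'a mat"
  have [simp]: "dim_row Q = N" "dim_col Q = N" "dim_row ?J = N" "dim_col ?J = N"
    using Q unfolding reverse_identity_mat_def by auto
  \<comment> \<open>The same entry solved for either index: each form collapses the sum of one of
    the two products to a single term.\<close>
  have J: "?J $$ (i, j) = (if j = N - 1 - i then 1 else 0)"
    "?J $$ (i, j) = (if i = N - 1 - j then 1 else 0)" if "i < N" "j < N" for i j
    using that unfolding reverse_identity_mat_def by auto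
  have JQ: "(?J * Q) $$ (i, j) = Q $$ (N - 1 - i, j)" if "i < N" "j < N" for i j
  proof -
    have "(?J * Q) $$ (i, j) = (\<Sum>k<N. ?J $$ (i, k) * Q $$ (k, j))"
      using that by (simp add: scalar_prod_def atLeast0LessThan)
    also have "\<dots> = (\<Sum>k<N. if k = N - 1 - i then Q $$ (k, j) else 0)"
      using that by (intro sum.cong) (auto simp: J(1))
    finally show ?thesis using that by simp
  qed
  have "(?J * Q * ?J) $$ (i, j) = Q $$ (N - 1 - i, N - 1 - j)" if "i < N" "j < N" for i j
  proof -
    have "(?J * Q * ?J) $$ (i, j) = (\<Sum>k<N. (?J * Q) $$ (i, k) * ?J $$ (k, j))"
      using that by (simp add: scalar_prod_def atLeast0LessThan)
    also have "\<dots> = (\<Sum>k<N. if k = N - 1 - j then Q $$ (N - 1 - i, k) else 0)"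
      using that by (intro sum.cong) (auto simp: J(2) JQ simp del: index_mult_mat)
    finally show ?thesis using that by simp
  qed
  then have "?J * Q * ?J = Q \<longleftrightarrow> (\<forall>i<N. \<forall>j<N. Q $$ (N - 1 - i, N - 1 - j) = Q $$ (i, j))"
    unfolding mat_eq_iff by simp
  moreover have "Q\<^sup>T = Q \<longleftrightarrow> (\<forall>i<N. \<forall>j<N. Q $$ (i, j) = Q $$ (j, i))"
    unfolding mat_eq_iff by auto
  ultimately show ?thesis unfolding bisymmetric_mat_def by auto
qed

section \<open>Enlarging the support of the Perron vector\<close>

text \<open>
  The invariant of the iteration: \<^term>\<open>b\<close> is the current isospectral modification of the original
  matrix, \<^term>\<open>v\<close> its Perron vector, and \<^term>\<open>\<sigma>\<close> the index permutation of \<open>J\<close>.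
\<close>
definition positive_on_support ::
  "nat \<Rightarrow> (nat \<Rightarrow> nat) \<Rightarrow> real \<Rightarrow> real \<Rightarrow> (nat \<Rightarrow> nat \<Rightarrow> real) \<Rightarrow> (nat \<Rightarrow> real) \<Rightarrow> bool" where
  "positive_on_support N \<sigma> \<rho> \<epsilon> b v \<longleftrightarrow>
     (\<forall>i<N. \<forall>j<N. b i j = b j i \<and> b (\<sigma> i) (\<sigma> j) = b i j \<and> 0 \<le> b i j + \<epsilon> * v i * v j \<and>
        (0 < v i \<longrightarrow> 0 < v j \<longrightarrow> 0 < b i j + \<epsilon> * v i * v j)) \<and>
     (\<forall>i<N. 0 \<le> v i \<and> v (\<sigma> i) = v i \<and> (\<Sum>j<N. b i j * v j) = \<rho> * v i) \<and>
     (\<Sum>i<N. (v i)\<^sup>2) = 1"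

text \<open>Entries between two indices of the support shrink by a controlled amount and stay
  positive for a small rotation. At all other entries the subtracted rank-one term is zero, so a
  nonnegative amount is added, which is positive wherever the new vector is positive at both
  indices.\<close>

lemma positive_on_support_enlarge:
  assumes \<sigma>: "\<And>i. i < N \<Longrightarrow> \<sigma> i < N" "\<And>i. i < N \<Longrightarrow> \<sigma> (\<sigma> i) = i"
    and "\<epsilon> > 0"
    and inv: "positive_on_support N \<sigma> \<rho> \<epsilon> b v"
    and bound: "\<And>\<mu>. poly (char_poly (mat N N (\<lambda>(i, j). b i j))) \<mu> = 0 \<Longrightarrow> \<mu> \<le> \<rho>"
    and k: "k < N" "v k = 0"
  obtains b' v' where "positive_on_support N \<sigma> \<rho> \<epsilon> b' v'"
    "char_poly (mat N N (\<lambda>(i, j). b' i j)) = char_poly (mat N N (\<lambda>(i, j). b i j))"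
    "{i. i < N \<and> v' i = 0} \<subset> {i. i < N \<and> v i = 0}"
proof -
  define Z where "Z = {i. i < N \<and> v i = 0}"
  have sym: "b i j = b j i" and b\<sigma>: "b (\<sigma> i) (\<sigma> j) = b i j"
    and nn: "0 \<le> b i j + \<epsilon> * v i * v j"
    and pos: "0 < v i \<Longrightarrow> 0 < v j \<Longrightarrow> 0 < b i j + \<epsilon> * v i * v j"
    if "i < N" "j < N" for i j using inv that unfolding positive_on_support_def by auto
  have v0: "0 \<le> v i" and v\<sigma>: "v (\<sigma> i) = v i" and bv: "(\<Sum>j<N. b i j * v j) = \<rho> * v i"
    if "i < N" for i using inv that unfolding positive_on_support_def by auto
  have v1: "(\<Sum>i<N. (v i)\<^sup>2) = 1" using inv unfolding positive_on_support_def by auto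
  have vpos: "0 < v i" if "i < N" "i \<notin> Z" for i using v0[of i] that unfolding Z_def by auto
  have Znn: "0 \<le> b i j" if "i \<in> Z" "j < N" for i j using nn[of i j] that unfolding Z_def by auto
  \<comment> \<open>At an index of \<open>Z\<close> the eigenvalue equation is a vanishing sum of
    nonnegative terms, so every coupling to the support of \<open>v\<close> is zero.\<close>
  have split: "b i j = 0" if "i \<in> Z" "j < N" "j \<notin> Z" for i j
  proof -
    have "(\<Sum>j<N. b i j * v j) = 0" using bv[of i] that unfolding Z_def by auto
    then have "b i j * v j = 0"
      by (subst (asm) sum_nonneg_eq_0_iff) (use that Znn v0 in auto)
    then show ?thesis using vpos[of j] that by auto
  qed
  have Zlt: "i < N" if "i \<in> Z" for i using that unfolding Z_def by simp
  have ZN: "Z \<subseteq> {..<N}" and fin: "finite Z" and ne: "Z \<noteq> {}" using k unfolding Z_def by auto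
  have \<sigma>Z: "\<sigma> i \<in> Z \<longleftrightarrow> i \<in> Z" if "i < N" for i using that \<sigma> v\<sigma> unfolding Z_def by auto
  obtain w \<mu> where w0: "\<And>i. 0 \<le> w i" and wZ: "\<And>i. i \<notin> Z \<Longrightarrow> w i = 0"
    and w\<sigma>: "\<And>i. i \<in> Z \<Longrightarrow> w (\<sigma> i) = w i" and w1: "(\<Sum>i\<in>Z. (w i)\<^sup>2) = 1"
    and bwZ: "\<And>i. i \<in> Z \<Longrightarrow> (\<Sum>j\<in>Z. b i j * w j) = \<mu> * w i"
  proof (rule nonneg_symmetric_perron[OF fin ne, of b \<sigma>])
    show "\<sigma> i \<in> Z" if "i \<in> Z" for i using \<sigma>Z that Zlt by auto
  qed (use Zlt sym \<sigma> b\<sigma> Znn in auto)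
  have w1N: "(\<Sum>i<N. (w i)\<^sup>2) = 1"
    unfolding w1[symmetric] using ZN by (intro sum.mono_neutral_right) (auto simp: wZ)
  \<comment> \<open>Because the couplings vanish, the eigenvector of the block extends by zero to
    the whole array.\<close>
  have bw: "(\<Sum>j<N. b i j * w j) = \<mu> * w i" if "i < N" for i
  proof -
    have *: "(\<Sum>j<N. b i j * w j) = (\<Sum>j\<in>Z. b i j * w j)"
      using ZN by (intro sum.mono_neutral_right) (auto simp: wZ)
    show ?thesis
    proof (cases "i \<in> Z")
      case True
      then show ?thesis using bwZ * by simp
    next
      case False
      then have "b i j = 0" if "j \<in> Z" for j
        using that split[of j i] sym[of i j] \<open>i < N\<close> ZN by auto
      then show ?thesis unfolding * using False by (simp add: wZ)
    qed
  qed
  obtain l where l: "l \<in> Z" "w l \<noteq> 0" using w1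
    by (metis (mono_tags, lifting) power_zero_numeral sum.neutral zero_neq_one)
  then have "l < N" using ZN by auto
  then have "\<mu> \<le> \<rho>" using bound eigenfunction_root_char_poly[of N b w \<mu> l] bw l by blast
  define \<eta> where "\<eta> = \<rho> - \<mu>"
  define \<delta> where "\<delta> = \<eta> + \<epsilon>"
  have \<delta>: "\<delta> > 0" using \<open>\<mu> \<le> \<rho>\<close> \<open>\<epsilon> > 0\<close> unfolding \<delta>_def \<eta>_def by simp
  define P where "P = {i. i < N \<and> 0 < v i}"
  \<comment> \<open>On the support the new entry will be the old one minus
    \<open>t * (\<delta> * v i * v j)\<close>, so \<open>t\<close> must lie below every ratio
    \<open>f (i, j)\<close>. Inserting 1 forces \<open>t < 1\<close>, and halving makes the
    inequalities strict.\<close>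
  define f where "f = (\<lambda>(i, j). (b i j + \<epsilon> * v i * v j) / (\<delta> * v i * v j))"
  define t where "t = Min (insert 1 (f ` (P \<times> P))) / 2"
  have finP: "finite P" unfolding P_def by simp
  have fpos: "0 < f x" if "x \<in> P \<times> P" for x
    using that pos \<delta> unfolding P_def f_def by auto
  have "0 < Min (insert 1 (f ` (P \<times> P)))" using finP fpos by (subst Min_gr_iff) auto
  then have t0: "0 < t" unfolding t_def by simp
  have "Min (insert 1 (f ` (P \<times> P))) \<le> 1" using finP by (intro Min_le) auto
  then have t1: "t < 1" unfolding t_def by simp
  have t: "t * (\<delta> * v i * v j) < b i j + \<epsilon> * v i * v j" if "i \<in> P" "j \<in> P" for i j
  proof -
    have "Min (insert 1 (f ` (P \<times> P))) \<le> f (i, j)" using finP that by (intro Min_le) auto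
    then have "t < f (i, j)" using fpos[of "(i, j)"] that unfolding t_def by auto
    then show ?thesis using that \<delta> unfolding P_def f_def by (simp add: pos_less_divide_eq)
  qed
  define s where "s = sqrt t"
  define c where "c = sqrt (1 - t)"
  have s0: "s > 0" and s2: "s\<^sup>2 = t" and c0: "c > 0" and c2: "c\<^sup>2 = 1 - t"
    using t0 t1 unfolding s_def c_def by auto
  define v' where "v' = (\<lambda>i. c * v i + s * w i)"
  \<comment> \<open>\<open>C\<close> lowers the eigenvalue at \<open>v\<close> from
    \<open>\<rho>\<close> to \<open>\<mu>\<close>. As \<open>w\<close> is orthogonal to
    \<open>v\<close>, it keeps the eigenvalue \<open>\<mu>\<close>, and so does the combination
    \<open>v'\<close>.\<close>
  define C where "C = (\<lambda>i j. b i j - \<eta> * v i * v j)"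
  define b' where "b' = (\<lambda>i j. C i j + \<eta> * v' i * v' j)"
  have vw: "v i * w i = 0" if "i < N" for i using that wZ[of i] unfolding Z_def by auto
  then have vw0: "(\<Sum>i<N. v i * w i) = 0" by (intro sum.neutral) blast
  have v'0: "0 \<le> v' i" if "i < N" for i using s0 c0 v0 w0 that unfolding v'_def by simp
  have v'1: "(\<Sum>i<N. (v' i)\<^sup>2) = 1"
  proof -
    have "(\<Sum>i<N. (v' i)\<^sup>2) = (\<Sum>i<N. c\<^sup>2 * (v i)\<^sup>2 + s\<^sup>2 * (w i)\<^sup>2 + 2 * c * s * (v i * w i))"
      unfolding v'_def by (intro sum.cong) (auto simp: power2_eq_square algebra_simps)
    then show ?thesis by (simp add: sum.distrib v1 w1N vw0 s2 c2 flip: sum_distrib_left)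
  qed
  have vv': "(\<Sum>i<N. v i * v' i) = c"
  proof -
    have "(\<Sum>i<N. v i * v' i) = (\<Sum>i<N. c * (v i)\<^sup>2 + s * (v i * w i))"
      unfolding v'_def by (intro sum.cong) (auto simp: power2_eq_square algebra_simps)
    then show ?thesis by (simp add: sum.distrib v1 vw0 flip: sum_distrib_left)
  qed
  have Cx: "(\<Sum>j<N. C i j * x j) = (\<Sum>j<N. b i j * x j) - \<eta> * v i * (\<Sum>j<N. v j * x j)" for x i
    unfolding C_def by (simp add: sum_distrib_left sum_subtractf algebra_simps)
  have Cv: "(\<Sum>j<N. C i j * v j) = \<mu> * v i" if "i < N" for i
    unfolding Cx bv[OF that] using v1 by (simp add: \<eta>_def algebra_simps flip: power2_eq_square)
  have bv': "(\<Sum>j<N. b i j * v' j) = c * (\<rho> * v i) + s * (\<mu> * w i)" if "i < N" for i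
    unfolding bv[OF that, symmetric] bw[OF that, symmetric] v'_def sum_distrib_left
    by (simp add: algebra_simps flip: sum.distrib)
  have Cv': "(\<Sum>j<N. C i j * v' j) = \<mu> * v' i" if "i < N" for i
    unfolding Cx bv'[OF that] vv' by (simp add: v'_def \<eta>_def algebra_simps)
  have b'v': "(\<Sum>j<N. b' i j * v' j) = \<rho> * v' i" if "i < N" for i
  proof -
    have "(\<Sum>j<N. b' i j * v' j) = (\<Sum>j<N. C i j * v' j) + \<eta> * v' i * (\<Sum>j<N. (v' j)\<^sup>2)"
      unfolding b'_def sum_distrib_left
      by (simp add: algebra_simps power2_eq_square flip: sum.distrib)
    then show ?thesis unfolding Cv'[OF that] v'1 by (simp add: \<eta>_def algebra_simps)
  qed
  \<comment> \<open>Both \<open>b\<close> and \<open>b'\<close> arise from \<open>C\<close> by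
    raising one eigenvalue \<open>\<mu>\<close> by \<open>\<eta>\<close>, at \<open>v\<close> and at
    \<open>v'\<close> respectively; the common linear factor is then cancelled.\<close>
  have "char_poly (mat N N (\<lambda>(i, j). b i j)) * [:- \<mu>, 1:] =
      char_poly (mat N N (\<lambda>(i, j). b' i j)) * [:- \<mu>, 1:]"
    using char_poly_rank_one_update[OF v1 Cv, of \<eta>] char_poly_rank_one_update[OF v'1 Cv', of \<eta>]
    unfolding b'_def by (simp add: C_def)
  then have cp: "char_poly (mat N N (\<lambda>(i, j). b' i j)) = char_poly (mat N N (\<lambda>(i, j). b i j))"
    by (simp del: mult_pCons_left mult_pCons_right)
  have entry: "b' i j + \<epsilon> * v' i * v' j = b i j + \<epsilon> * v i * v j - \<delta> * v i * v j + \<delta> * (v' i * v' j)" for i j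
    unfolding b'_def C_def \<delta>_def by (simp add: algebra_simps)
  have entry_pos: "0 < b' i j + \<epsilon> * v' i * v' j" if "i \<in> P" "j \<in> P" for i j
  proof -
    have "w i = 0" "w j = 0" using that wZ unfolding P_def Z_def by auto
    then have v': "v' i * v' j = (1 - t) * (v i * v j)"
      unfolding v'_def c2[symmetric] by (simp add: power2_eq_square)
    show ?thesis unfolding entry v' using t[OF that] by (simp add: algebra_simps)
  qed
  have entry_eq: "b' i j + \<epsilon> * v' i * v' j = b i j + \<epsilon> * v i * v j + \<delta> * (v' i * v' j)"
    if "i < N" "j < N" "\<not> (i \<in> P \<and> j \<in> P)" for i j
    using that vpos unfolding entry P_def Z_def by auto
  have main: "0 \<le> b' i j + \<epsilon> * v' i * v' j \<and>
        (0 < v' i \<longrightarrow> 0 < v' j \<longrightarrow> 0 < b' i j + \<epsilon> * v' i * v' j)" if "i < N" "j < N" for i j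
  proof (cases "i \<in> P \<and> j \<in> P")
    case True
    then show ?thesis using entry_pos[of i j] by simp
  next
    case False
    show ?thesis unfolding entry_eq[OF that False]
      using nn[OF that] v'0 that \<delta> by (simp add: add_nonneg_pos)
  qed
  have v'\<sigma>: "v' (\<sigma> i) = v' i" if "i < N" for i
  proof -
    have "w (\<sigma> i) = w i" using w\<sigma> wZ \<sigma>Z[OF that] by (cases "i \<in> Z") auto
    then show ?thesis unfolding v'_def v\<sigma>[OF that] by simp
  qed
  have inv': "positive_on_support N \<sigma> \<rho> \<epsilon> b' v'"
    unfolding positive_on_support_def
  proof (intro conjI allI impI)
    fix i j assume ij: "i < N" "j < N"
    show "b' i j = b' j i" unfolding b'_def C_def using sym[OF ij] by (simp add: mult_ac)
    show "b' (\<sigma> i) (\<sigma> j) = b' i j" unfolding b'_def C_def using ij by (simp add: b\<sigma> v\<sigma> v'\<sigma>)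
  qed (use main v'0 v'\<sigma> b'v' v'1 in auto)
  \<comment> \<open>Both summands of \<open>v'\<close> are nonnegative, so no new zero can appear,
    while the zero at \<open>l\<close> disappears.\<close>
  have "v i = 0" if "i < N" "v' i = 0" for i
  proof -
    have "0 \<le> c * v i" "0 \<le> s * w i" using c0 s0 v0 w0 that by auto
    then have "c * v i = 0" using that unfolding v'_def by linarith
    then show ?thesis using c0 by simp
  qed
  moreover have "v' l \<noteq> 0" "v l = 0" using l s0 unfolding v'_def Z_def by auto
  ultimately have "{i. i < N \<and> v' i = 0} \<subset> {i. i < N \<and> v i = 0}" using \<open>l < N\<close> by blast
  then show ?thesis by (rule that[OF inv' cp])
qed

text \<open>Induction on the number of zeros of \<open>v\<close>. The spectral bound survives each
  step because the characteristic polynomial does not change.\<close>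

lemma positive_on_full_support:
  assumes \<sigma>: "\<And>i. i < N \<Longrightarrow> \<sigma> i < N" "\<And>i. i < N \<Longrightarrow> \<sigma> (\<sigma> i) = i"
    and "\<epsilon> > 0"
    and "positive_on_support N \<sigma> \<rho> \<epsilon> b v"
    and "\<And>\<mu>. poly (char_poly (mat N N (\<lambda>(i, j). b i j))) \<mu> = 0 \<Longrightarrow> \<mu> \<le> \<rho>"
  obtains b' v' where "positive_on_support N \<sigma> \<rho> \<epsilon> b' v'" "\<And>i. i < N \<Longrightarrow> 0 < v' i"
    "char_poly (mat N N (\<lambda>(i, j). b' i j)) = char_poly (mat N N (\<lambda>(i, j). b i j))"
proof -
  have "\<exists>b' v'. positive_on_support N \<sigma> \<rho> \<epsilon> b' v' \<and> (\<forall>i<N. 0 < v' i) \<and>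
    char_poly (mat N N (\<lambda>(i, j). b' i j)) = char_poly (mat N N (\<lambda>(i, j). b i j))"
    using assms(4,5)
  proof (induction "card {i. i < N \<and> v i = 0}" arbitrary: b v rule: less_induct)
    case less
    show ?case
    proof (cases "\<exists>k<N. v k = 0")
      case True
      then obtain k where "k < N" "v k = 0" by blast
      then obtain b' v' where b'v': "positive_on_support N \<sigma> \<rho> \<epsilon> b' v'"
        "char_poly (mat N N (\<lambda>(i, j). b' i j)) = char_poly (mat N N (\<lambda>(i, j). b i j))"
        and sub: "{i. i < N \<and> v' i = 0} \<subset> {i. i < N \<and> v i = 0}"
        using positive_on_support_enlarge[OF \<sigma> \<open>\<epsilon> > 0\<close> less.prems] by blast
      have "card {i. i < N \<and> v' i = 0} < card {i. i < N \<and> v i = 0}"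
        using sub by (intro psubset_card_mono) auto
      from less.hyps[OF this b'v'(1)] show ?thesis using b'v'(2) less.prems(2) by simp
    next
      case False
      moreover have "\<forall>i<N. 0 \<le> v i" using less.prems(1) unfolding positive_on_support_def by auto
      ultimately show ?thesis using less.prems(1) by (metis order_le_less)
    qed
  qed
  then show ?thesis using that by blast
qed

section \<open>Starting vector, iteration and final eigenvalue shift\<close>

theorem theorem4p2:
  fixes n :: nat and Q :: "real mat" and ev :: "nat \<Rightarrow> real" and \<epsilon> :: real
  assumes "Q \<in> carrier_mat (n + 1) (n + 1)"
    and "nonnegative_mat Q"
    and "bisymmetric_mat Q"
    and "has_eigenvalues Q ev"
    and "\<And>i j. i \<le> j \<Longrightarrow> j \<le> n \<Longrightarrow> ev j \<le> ev i"
    and "\<epsilon> > 0"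
  shows "\<exists>Q' :: real mat. Q' \<in> carrier_mat (n + 1) (n + 1) \<and> positive_mat Q' \<and>
           bisymmetric_mat Q' \<and> has_eigenvalues Q' (ev(0 := ev 0 + \<epsilon>))"
proof -
  define N where "N = n + 1"
  define q where "q = (\<lambda>i j. Q $$ (i, j))"
  define \<sigma> where "\<sigma> = (\<lambda>i. N - 1 - i)"
  have Q: "Q \<in> carrier_mat N N" using assms unfolding N_def by simp
  have Qq: "mat N N (\<lambda>(i, j). q i j) = Q" using Q unfolding q_def by (intro eq_matI) auto
  have \<sigma>: "\<And>i. i < N \<Longrightarrow> \<sigma> i < N" "\<And>i. i < N \<Longrightarrow> \<sigma> (\<sigma> i) = i" unfolding \<sigma>_def by auto
  have nn: "0 \<le> q i j" if "i < N" "j < N" for i j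
    using assms(2) that Q unfolding nonnegative_mat_def q_def by auto
  have sym: "q i j = q j i" and q\<sigma>: "q (\<sigma> i) (\<sigma> j) = q i j" if "i < N" "j < N" for i j
    using assms(3) that unfolding bisymmetric_mat_iff[OF Q] q_def \<sigma>_def by auto
  have cpQ: "char_poly Q = (\<Prod>i<N. [:- ev i, 1:])"
    using assms(4) Q unfolding has_eigenvalues_def by simp
  then have root: "poly (char_poly Q) \<mu> = 0 \<longleftrightarrow> (\<exists>i<N. \<mu> = ev i)" for \<mu>
    by (auto simp: poly_prod prod_zero_iff)
  have bound: "\<mu> \<le> ev 0" if "poly (char_poly Q) \<mu> = 0" for \<mu>
    using that assms(5) unfolding root N_def by auto
  obtain w \<mu> where w0: "\<And>i. 0 \<le> w i" and w\<sigma>: "\<And>i. i \<in> {..<N} \<Longrightarrow> w (\<sigma> i) = w i"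
    and w1: "(\<Sum>i<N. (w i)\<^sup>2) = 1"
    and qw: "\<And>i. i \<in> {..<N} \<Longrightarrow> (\<Sum>j<N. q i j * w j) = \<mu> * w i"
    and max: "\<And>x. (\<Sum>i<N. \<Sum>j<N. q i j * x i * x j) \<le> \<mu> * (\<Sum>i<N. (x i)\<^sup>2)"
  proof (rule nonneg_symmetric_perron[of "{..<N}" q \<sigma>])
    show "{..<N} \<noteq> {}" unfolding N_def by auto
  qed (use \<sigma> nn sym q\<sigma> in auto)
  \<comment> \<open>One inequality holds because \<open>\<mu>\<close> is an eigenvalue; the other
    because an eigenvector for \<open>ev 0\<close> has Rayleigh quotient \<open>ev 0\<close>, which
    \<open>\<mu>\<close> bounds.\<close>
  have "\<mu> = ev 0"
  proof (rule antisym)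
    obtain k where "k < N" "w k \<noteq> 0"
      using w1 by (metis (mono_tags, lifting) lessThan_iff power_zero_numeral sum.neutral zero_neq_one)
    then have "poly (char_poly Q) \<mu> = 0"
      using eigenfunction_root_char_poly[of N q w \<mu> k] qw unfolding Qq by auto
    then show "\<mu> \<le> ev 0" by (rule bound)
  next
    have "poly (char_poly Q) (ev 0) = 0" unfolding root N_def by auto
    then obtain x where x: "x \<in> carrier_vec N" "x \<noteq> 0\<^sub>v N" "Q *\<^sub>v x = ev 0 \<cdot>\<^sub>v x"
      using eigenvalue_root_char_poly[OF Q] Q unfolding eigenvalue_def eigenvector_def by auto
    have Qx: "(\<Sum>j<N. q i j * x $ j) = ev 0 * x $ i" if "i < N" for i
      using arg_cong[OF x(3), of "\<lambda>y. y $ i"] that x(1) Q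
      by (simp add: q_def scalar_prod_def atLeast0LessThan)
    have "(\<Sum>i<N. \<Sum>j<N. q i j * x $ i * x $ j) = (\<Sum>i<N. x $ i * (\<Sum>j<N. q i j * x $ j))"
      by (simp add: sum_distrib_left mult_ac)
    also have "\<dots> = ev 0 * (\<Sum>i<N. (x $ i)\<^sup>2)"
      unfolding sum_distrib_left[of "ev 0" "\<lambda>i. (x $ i)\<^sup>2"]
      by (intro sum.cong) (simp_all add: Qx power2_eq_square)
    finally have "ev 0 * (\<Sum>i<N. (x $ i)\<^sup>2) \<le> \<mu> * (\<Sum>i<N. (x $ i)\<^sup>2)"
      using max[of "\<lambda>i. x $ i"] by simp
    moreover obtain k where "k < N" "x $ k \<noteq> 0"
      using x(1,2) by (metis carrier_vecD eq_vecI index_zero_vec)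
    then have "0 < (\<Sum>i<N. (x $ i)\<^sup>2)" by (intro sum_pos2[of _ k]) auto
    ultimately show "ev 0 \<le> \<mu>" by simp
  qed
  \<comment> \<open>The invariant holds at the start since \<open>q\<close> is nonnegative and the
    rank-one term is positive on the support of \<open>w\<close>.\<close>
  have "positive_on_support N \<sigma> (ev 0) \<epsilon> q w"
    unfolding positive_on_support_def
    using sym q\<sigma> nn w0 w1 w\<sigma> qw \<open>\<epsilon> > 0\<close> \<open>\<mu> = ev 0\<close> by (auto intro: add_nonneg_pos)
  then obtain b v where inv: "positive_on_support N \<sigma> (ev 0) \<epsilon> b v" and v: "\<And>i. i < N \<Longrightarrow> 0 < v i"
    and cpb: "char_poly (mat N N (\<lambda>(i, j). b i j)) = char_poly Q"
    using positive_on_full_support[OF \<sigma> \<open>\<epsilon> > 0\<close>] bound unfolding Qq[symmetric] by blast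
  \<comment> \<open>The iteration has left the spectrum unchanged; only this last rank-one term, now
    along a positive vector, raises the top eigenvalue.\<close>
  define Q' where "Q' = mat N N (\<lambda>(i, j). b i j + \<epsilon> * v i * v j)"
  have Q': "Q' \<in> carrier_mat N N" unfolding Q'_def by simp
  have "positive_mat Q'"
    using inv v unfolding positive_on_support_def positive_mat_def Q'_def by auto
  moreover have "bisymmetric_mat Q'"
    unfolding bisymmetric_mat_iff[OF Q']
    using inv \<sigma>(1) unfolding positive_on_support_def Q'_def by (auto simp: \<sigma>_def)
  moreover have "char_poly Q' = (\<Prod>i<N. [:- (ev(0 := ev 0 + \<epsilon>)) i, 1:])"
  proof -
    have "char_poly Q' * [:- ev 0, 1:] = char_poly Q * [:- (ev 0 + \<epsilon>), 1:]"
      unfolding Q'_def cpb[symmetric]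
      by (rule char_poly_rank_one_update) (use inv in \<open>auto simp: positive_on_support_def\<close>)
    \<comment> \<open>Splitting off the factor at index 0 shows that the two products differ only
      there.\<close>
    also have "\<dots> = (\<Prod>i<N. [:- (ev(0 := ev 0 + \<epsilon>)) i, 1:]) * [:- ev 0, 1:]"
      unfolding cpQ N_def
      by (simp add: prod.lessThan_Suc_shift mult_ac del: prod.lessThan_Suc mult_pCons_left mult_pCons_right)
    finally show ?thesis by (simp del: mult_pCons_right mult_pCons_left)
  qed
  ultimately show ?thesis using Q' unfolding has_eigenvalues_def N_def by (intro exI[of _ Q']) simp
qed

end
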